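(* (Abstract nearly finite proper Wallman admissible filters $\Theta\subseteq\mathcal{P}(\mathbb{P})$ are dual to concrete $*$-coinitial filters $\Theta\subseteq\mathcal{C}_X(\mathbb{P})$ where $\mathbb{P}\subseteq\mathcal{O}(X)$ is a basis of relatively compact sets on a locally compact $T_1$ space $X\neq\emptyset$.) Precisely: (1) Let $(\mathbb{P},\leq)$ be a poset and let $\Theta\subseteq\mathcal{P}(\mathbb{P})$ be a nearly finite, Wallman admissible filter that is proper, i.e. $\Theta\neq\mathcal{P}(\mathbb{P})$. Then the spectrum $\widehat\Theta$ is a non-empty locally compact $T_1$ space, $(\widehat\Theta_p)_{p\in\mathbb{P}}$ is a basis of $\widehat\Theta$ consisting of relatively compact sets, $p\leq q\Leftrightarrow\widehat\Theta_p\subseteq\widehat\Theta_q$ for all $p,q\in\mathbb{P}$, and $\{\{\widehat\Theta_c:c\in C\}:C\in\Theta\}$ is a $*$-coinitial family of covers of $\widehat\Theta$ by elements of the basis $\{\widehat\Theta_p:p\in\mathbb{P}\}$. (2) Conversely, let $X\neq\emptyset$ be a $T_1$ space, let $\mathbb{P}\subseteq\mathcal{O}(X)$ be a basis of $X$ consisting of relatively compact sets, ordered by $\leq\ =\ \subseteq$, and let $\Theta\subseteq\mathcal{C}_X(\mathbb{P})$ be a $*$-coinitial filter. Then $\Theta$ is nearly finite and Wallman admissible, and $\widehat\Theta$ is homeomorphic to $X$.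
   Context: A set is relatively compact if its closure is compact; a space is locally compact if it has a basis of relatively compact open sets. $\mathcal{O}(X)$ is the family of open sets of $X$ and $\mathcal{C}_X(\mathbb{P})=\{C\subseteq\mathbb{P}:X\subseteq\bigcup C\}$. Let $(\mathbb{P},\leq)$ be a poset and $\Theta\subseteq\mathcal{P}(\mathbb{P})$ (power set). For $R,S\subseteq\mathbb{P}$, $R\leq S$ ($R$ refines $S$) means $\forall r\in R\ \exists s\in S\ (r\leq s)$, and $\Theta^\leq=\{D\subseteq\mathbb{P}:\exists C\in\Theta\ (C\leq D)\}$. $\Theta$ is an up-set if $\Theta^\leq\subseteq\Theta$; directed if for every finite (possibly empty) $\mathcal{G}\subseteq\Theta$ there is $C\in\Theta$ with $C\leq D$ for all $D\in\mathcal{G}$ (so $\Theta\neq\emptyset$); a filter if it is a directed up-set. $\Theta$ is Wallman admissible if for all $p,q\in\mathbb{P}$: $p\leq q\Leftrightarrow\forall C\in\Theta\ ((C\setminus\{p\})\cup\{q\}\in\Theta)$. Spectrum: $R\subseteq\mathbb{P}$ is $\Theta$-Cauchy if $C\cap R\neq\emptyset$ for all $C\in\Theta$; $\Theta$-round if for every $r\in R$ there is $C\in\Theta$ with $c\leq r$ for all $c\in C\cap R$. $\widehat\Theta$ is the set of all $\Theta$-round $\Theta$-Cauchy ($\leq$-)up-sets $R\subseteq\mathbb{P}$, with the topology having subbasis $(\widehat\Theta_p)_{p\in\mathbb{P}}$, where $\widehat\Theta_p=\{R\in\widehat\Theta:p\in R\}$. $S\subseteq\mathbb{P}$ is $\Theta^\leq$-near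 if there is $D\subseteq\mathbb{P}$ with $D\notin\Theta^\leq$ and $D\cup\{s\}\in\Theta^\leq$ for all $s\in S$. For $C\subseteq\mathbb{P}$ and $p\in\mathbb{P}$, $Cp=\{c\in C:\{c,p\}\text{ is }\Theta^\leq\text{-near}\}$, and $\Theta p=\{Cp:C\in\Theta\}$. $\Theta$ is nearly finite if for every $p\in\mathbb{P}$, every element of $\Theta p$ is refined by some finite element of $\Theta p$. For a set $Y$, a family $\mathbb{Q}\subseteq\mathcal{P}(Y)$ ordered by $\subseteq$, $C\subseteq\mathbb{Q}$ and $p\in\mathbb{Q}$, put $C*p=\{c\in C:c\cap p\neq\emptyset\}$. A family $\Psi\subseteq\mathcal{C}_Y(\mathbb{Q})$ is $*$-coinitial if for every $p\in\mathbb{Q}$ and every $D\in\mathcal{C}_Y(\mathbb{Q})$ there is $C\in\Psi$ such that $C*p$ refines $D$. *)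

theory Defs
  imports "HOL-Analysis.Analysis"
begin

text \<open>
  A poset is given by a carrier \<open>P\<close> and a relation \<open>le\<close> whose values matter only on \<open>P\<close>; thus a
  family of sets ordered by inclusion is the pair \<open>P\<close>, \<open>(\<subseteq>)\<close>.
\<close>

definition poset_on :: "'a set \<Rightarrow> ('a \<Rightarrow> 'a \<Rightarrow> bool) \<Rightarrow> bool" where
  "poset_on P le \<longleftrightarrow> reflp_on P le \<and> transp_on P le \<and> antisymp_on P le"

definition refines :: "('a \<Rightarrow> 'a \<Rightarrow> bool) \<Rightarrow> 'a set \<Rightarrow> 'a set \<Rightarrow> bool" where
  "refines le R S \<longleftrightarrow> (\<forall>r\<in>R. \<exists>s\<in>S. le r s)"

definition up_closure :: "'a set \<Rightarrow> ('a \<Rightarrow> 'a \<Rightarrow> bool) \<Rightarrow> 'a set set \<Rightarrow> 'a set set" where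
  "up_closure P le \<Theta> = {D. D \<subseteq> P \<and> (\<exists>C\<in>\<Theta>. refines le C D)}"

definition directed_family :: "('a \<Rightarrow> 'a \<Rightarrow> bool) \<Rightarrow> 'a set set \<Rightarrow> bool" where
  "directed_family le \<Theta> \<longleftrightarrow>
     (\<forall>\<G>. finite \<G> \<and> \<G> \<subseteq> \<Theta> \<longrightarrow> (\<exists>C\<in>\<Theta>. \<forall>D\<in>\<G>. refines le C D))"

definition filter_family :: "'a set \<Rightarrow> ('a \<Rightarrow> 'a \<Rightarrow> bool) \<Rightarrow> 'a set set \<Rightarrow> bool" where
  "filter_family P le \<Theta> \<longleftrightarrow>
     \<Theta> \<subseteq> Pow P \<and> directed_family le \<Theta> \<and> up_closure P le \<Theta> \<subseteq> \<Theta>"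

definition Wallman_admissible :: "'a set \<Rightarrow> ('a \<Rightarrow> 'a \<Rightarrow> bool) \<Rightarrow> 'a set set \<Rightarrow> bool" where
  "Wallman_admissible P le \<Theta> \<longleftrightarrow>
     (\<forall>p\<in>P. \<forall>q\<in>P. le p q \<longleftrightarrow> (\<forall>C\<in>\<Theta>. (C - {p}) \<union> {q} \<in> \<Theta>))"

definition near :: "'a set \<Rightarrow> 'a set set \<Rightarrow> 'a set \<Rightarrow> bool" where
  "near P \<Xi> S \<longleftrightarrow> (\<exists>D. D \<subseteq> P \<and> D \<notin> \<Xi> \<and> (\<forall>s\<in>S. D \<union> {s} \<in> \<Xi>))"

definition near_part ::
    "'a set \<Rightarrow> ('a \<Rightarrow> 'a \<Rightarrow> bool) \<Rightarrow> 'a set set \<Rightarrow> 'a set \<Rightarrow> 'a \<Rightarrow> 'a set" where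
  "near_part P le \<Theta> C p = {c \<in> C. near P (up_closure P le \<Theta>) {c, p}}"

definition near_parts ::
    "'a set \<Rightarrow> ('a \<Rightarrow> 'a \<Rightarrow> bool) \<Rightarrow> 'a set set \<Rightarrow> 'a \<Rightarrow> 'a set set" where
  "near_parts P le \<Theta> p = {near_part P le \<Theta> C p | C. C \<in> \<Theta>}"

definition nearly_finite :: "'a set \<Rightarrow> ('a \<Rightarrow> 'a \<Rightarrow> bool) \<Rightarrow> 'a set set \<Rightarrow> bool" where
  "nearly_finite P le \<Theta> \<longleftrightarrow>
     (\<forall>p\<in>P. \<forall>D\<in>near_parts P le \<Theta> p. \<exists>F\<in>near_parts P le \<Theta> p. finite F \<and> refines le F D)"

definition Cauchy_subset :: "'a set set \<Rightarrow> 'a set \<Rightarrow> bool" where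
  "Cauchy_subset \<Theta> R \<longleftrightarrow> (\<forall>C\<in>\<Theta>. C \<inter> R \<noteq> {})"

definition round_subset :: "('a \<Rightarrow> 'a \<Rightarrow> bool) \<Rightarrow> 'a set set \<Rightarrow> 'a set \<Rightarrow> bool" where
  "round_subset le \<Theta> R \<longleftrightarrow> (\<forall>r\<in>R. \<exists>C\<in>\<Theta>. \<forall>c\<in>C \<inter> R. le c r)"

definition upset_in :: "'a set \<Rightarrow> ('a \<Rightarrow> 'a \<Rightarrow> bool) \<Rightarrow> 'a set \<Rightarrow> bool" where
  "upset_in P le R \<longleftrightarrow> R \<subseteq> P \<and> (\<forall>r\<in>R. \<forall>p\<in>P. le r p \<longrightarrow> p \<in> R)"

definition spectrum :: "'a set \<Rightarrow> ('a \<Rightarrow> 'a \<Rightarrow> bool) \<Rightarrow> 'a set set \<Rightarrow> 'a set set" where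
  "spectrum P le \<Theta> = {R. upset_in P le R \<and> round_subset le \<Theta> R \<and> Cauchy_subset \<Theta> R}"

definition spectrum_at ::
    "'a set \<Rightarrow> ('a \<Rightarrow> 'a \<Rightarrow> bool) \<Rightarrow> 'a set set \<Rightarrow> 'a \<Rightarrow> 'a set set" where
  "spectrum_at P le \<Theta> p = {R \<in> spectrum P le \<Theta>. p \<in> R}"

text \<open>
  \<^const>\<open>topology_generated_by\<close> takes the union of the given sets as its underlying set. The whole
  spectrum is inserted (as the empty intersection of subbasic sets), so that it is the underlying
  set for every \<open>\<Theta>\<close>.
\<close>

definition spectrum_topology ::
    "'a set \<Rightarrow> ('a \<Rightarrow> 'a \<Rightarrow> bool) \<Rightarrow> 'a set set \<Rightarrow> 'a set topology" where
  "spectrum_topology P le \<Theta> =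
     topology_generated_by (insert (spectrum P le \<Theta>) (spectrum_at P le \<Theta> ` P))"

lemma topspace_spectrum_topology [simp]:
  "topspace (spectrum_topology P le \<Theta>) = spectrum P le \<Theta>"
  by (auto simp: spectrum_topology_def spectrum_at_def)

text \<open>The counterpart of \<^const>\<open>topological_basis\<close> for abstract topologies.\<close>

definition topology_basis :: "'a topology \<Rightarrow> 'a set set \<Rightarrow> bool" where
  "topology_basis X B \<longleftrightarrow>
     (\<forall>b\<in>B. openin X b) \<and> (\<forall>U. openin X U \<longrightarrow> (\<exists>B'. B' \<subseteq> B \<and> \<Union>B' = U))"

definition relatively_compact_in :: "'a topology \<Rightarrow> 'a set \<Rightarrow> bool" where
  "relatively_compact_in X S \<longleftrightarrow> S \<subseteq> topspace X \<and> compactin X (X closure_of S)"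

text \<open>
  For spaces that are not Hausdorff this is stronger than \<^const>\<open>locally_compact_space\<close>, which only
  asks for some compact neighbourhood of each point.
\<close>

definition rc_locally_compact_space :: "'a topology \<Rightarrow> bool" where
  "rc_locally_compact_space X \<longleftrightarrow>
     (\<exists>B. topology_basis X B \<and> (\<forall>b\<in>B. relatively_compact_in X b))"

definition covers :: "'a set \<Rightarrow> 'a set set \<Rightarrow> 'a set set set" where
  "covers Y Q = {C. C \<subseteq> Q \<and> Y \<subseteq> \<Union>C}"

definition star_part :: "'a set set \<Rightarrow> 'a set \<Rightarrow> 'a set set" where
  "star_part C p = {c \<in> C. c \<inter> p \<noteq> {}}"

definition star_coinitial :: "'a set \<Rightarrow> 'a set set \<Rightarrow> 'a set set set \<Rightarrow> bool" where
  "star_coinitial Y Q \<Psi> \<longleftrightarrow>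
     \<Psi> \<subseteq> covers Y Q \<and>
     (\<forall>p\<in>Q. \<forall>D\<in>covers Y Q. \<exists>C\<in>\<Psi>. refines (\<subseteq>) (star_part C p) D)"

end

theory Submission
  imports Defs
begin

text \<open>
  For a filter \<open>\<Theta>\<close> everything can be read off from the sets that do \<^emph>\<open>not\<close> belong to \<open>\<Theta>\<close>. A set
  \<open>R\<close> is Cauchy iff its complement is outside \<open>\<Theta>\<close>, and \<open>R\<close> is a point of the spectrum iff its
  complement is a \<^emph>\<open>maximal\<close> set outside \<open>\<Theta>\<close> (\<open>spectrum_iff\<close>). One should think of
  \<open>\<Theta>\<close> as the covers of a space, of a set outside \<open>\<Theta>\<close> as a family missing some point, and of a
  maximal one as the family of all basic sets that miss one given point.

  For the abstract direction, points must be produced from sets outside \<open>\<Theta>\<close>. The key is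
  \<open>spectrum_separates\<close>: if \<open>D\<close> is not in \<open>\<Theta>\<close> but \<open>D \<union> {p}\<close> is, then some point of the spectrum
  contains \<open>p\<close> and avoids \<open>D\<close>. It is an application of Zorn's lemma. If a chain of sets above \<open>D\<close>
  outside \<open>\<Theta>\<close> had its union in \<open>\<Theta>\<close>, near finiteness would yield a member of \<open>\<Theta>\<close> whose part near
  \<open>p\<close> is finite and refines the union, hence refines a single member \<open>E\<close> of the chain. Then \<open>E\<close>
  enlarged by elements not near \<open>p\<close> is in \<open>\<Theta>\<close>, and so is \<open>E \<union> {p}\<close>. In a space this forces
  \<open>E\<close> to be a cover, since \<open>p\<close> is disjoint from the sets not near it. Abstractly,
  \<open>mem_if_mem_insert_if_mem_far\<close> derives it from admissibility, which shows that an element below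
  two elements that are not near each other is the least element and can be dropped.

  All the rest follows by separation. It turns nearness of \<open>p\<close> and \<open>q\<close> into \<open>p\<close> and \<open>q\<close> having a
  common point, the order into inclusion of basic open sets, and, with near finiteness, it shows that
  a cover of the spectrum containing all elements not near \<open>p\<close> belongs to \<open>\<Theta>\<close> (\<open>far_cover_mem\<close>).
  Every cover \<open>D\<close> becomes one of these when the elements not near \<open>p\<close> are added, which gives
  coinitiality. Near finiteness applied to the enlarged cover gives a finite part of \<open>D\<close> covering the
  closure of the basic set of \<open>p\<close>.

  In the concrete direction coinitiality says that a cover containing all basic sets disjoint from
  some basic \<open>p\<close> belongs to \<open>\<Theta>\<close> (\<open>disjoint_cover_mem\<close>). Hence near means intersecting,
  compactness of closures gives near finiteness, and the point \<open>x\<close> corresponds to the family of its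
  basic neighbourhoods. This family is in the spectrum because \<open>T\<^sub>1\<close> lets all points other than \<open>x\<close>
  be covered by basic sets that miss \<open>x\<close>.
\<close>

section \<open>Filters on a poset and the points of their spectrum\<close>

locale poset_filter =
  fixes P :: "'a set" and le :: "'a \<Rightarrow> 'a \<Rightarrow> bool" and \<Theta> :: "'a set set"
  assumes poset: "poset_on P le"
    and filt: "filter_family P le \<Theta>"
begin

lemma le_refl: "p \<in> P \<Longrightarrow> le p p"
  using poset by (auto simp: poset_on_def reflp_on_def)

lemma le_antisym: "\<lbrakk>le p q; le q p; p \<in> P; q \<in> P\<rbrakk> \<Longrightarrow> p = q"
  using poset unfolding poset_on_def antisymp_on_def by blast

lemma mem_subset: "C \<in> \<Theta> \<Longrightarrow> C \<subseteq> P"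
  using filt by (auto simp: filter_family_def)

lemma mem_refined: "\<lbrakk>C \<in> \<Theta>; refines le C D; D \<subseteq> P\<rbrakk> \<Longrightarrow> D \<in> \<Theta>"
  using filt by (auto simp: filter_family_def up_closure_def)

lemma refines_superset: "\<lbrakk>C \<subseteq> P; C \<subseteq> D\<rbrakk> \<Longrightarrow> refines le C D"
  unfolding refines_def using le_refl by blast

lemma mem_superset: "\<lbrakk>C \<in> \<Theta>; C \<subseteq> D; D \<subseteq> P\<rbrakk> \<Longrightarrow> D \<in> \<Theta>"
  using mem_refined refines_superset mem_subset by blast

lemma common_refinement:
  assumes "C \<in> \<Theta>" "D \<in> \<Theta>"
  obtains E where "E \<in> \<Theta>" "refines le E C" "refines le E D"
proof -
  have "directed_family le \<Theta>" using filt by (simp add: filter_family_def)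
  then have "finite {C, D} \<and> {C, D} \<subseteq> \<Theta> \<longrightarrow> (\<exists>E\<in>\<Theta>. \<forall>A\<in>{C, D}. refines le E A)"
    unfolding directed_family_def by (rule spec)
  then show thesis using assms that by auto
qed

lemma carrier_mem: "P \<in> \<Theta>"
proof -
  have "directed_family le \<Theta>" using filt by (simp add: filter_family_def)
  then obtain C where "C \<in> \<Theta>"
    unfolding directed_family_def by (auto dest: spec[of _ "{}"])
  then show ?thesis using mem_superset[of C P] mem_subset[of C] by simp
qed

lemma up_closure_eq: "up_closure P le \<Theta> = \<Theta>"
proof
  show "up_closure P le \<Theta> \<subseteq> \<Theta>" using filt by (simp add: filter_family_def)
  show "\<Theta> \<subseteq> up_closure P le \<Theta>"
    using refines_superset[OF _ subset_refl] mem_subset by (auto simp: up_closure_def)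
qed

text \<open>Nearness of \<open>{p, q}\<close>; the up-closure drops out, as a filter is its own up-closure.\<close>

definition nearby :: "'a \<Rightarrow> 'a \<Rightarrow> bool" where
  "nearby p q \<longleftrightarrow> (\<exists>D\<subseteq>P. D \<notin> \<Theta> \<and> insert p D \<in> \<Theta> \<and> insert q D \<in> \<Theta>)"

lemma near_part_eq: "near_part P le \<Theta> C p = {c \<in> C. nearby c p}"
  by (auto simp: near_part_def near_def nearby_def up_closure_eq)

lemma nearly_finite_iff:
  "nearly_finite P le \<Theta> \<longleftrightarrow>
     (\<forall>p\<in>P. \<forall>C\<in>\<Theta>. \<exists>F\<in>\<Theta>. finite {f \<in> F. nearby f p} \<and>
        refines le {f \<in> F. nearby f p} {c \<in> C. nearby c p})"
  unfolding nearly_finite_def near_parts_def near_part_eq setcompr_eq_image by simp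

lemma Cauchy_subset_iff: "R \<subseteq> P \<Longrightarrow> Cauchy_subset \<Theta> R \<longleftrightarrow> P - R \<notin> \<Theta>"
  unfolding Cauchy_subset_def
proof
  assume "R \<subseteq> P" "\<forall>C\<in>\<Theta>. C \<inter> R \<noteq> {}"
  then show "P - R \<notin> \<Theta>" by blast
next
  assume "R \<subseteq> P" "P - R \<notin> \<Theta>"
  moreover have "P - R \<in> \<Theta>" if "C \<in> \<Theta>" "C \<inter> R = {}" for C
    using that mem_subset[OF that(1)] by (intro mem_superset[OF that(1)]) auto
  ultimately show "\<forall>C\<in>\<Theta>. C \<inter> R \<noteq> {}" by blast
qed

text \<open>
  If \<open>C\<close> witnesses roundness at \<open>r\<close>, then \<open>C\<close> refines \<open>(P - R) \<union> {r}\<close>, which is thus in \<open>\<Theta>\<close>.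
  Conversely, \<open>(P - R) \<union> {r}\<close> itself witnesses roundness at \<open>r\<close>, as it meets \<open>R\<close> in \<open>r\<close> only.
\<close>

lemma spectrum_iff:
  "R \<in> spectrum P le \<Theta> \<longleftrightarrow> R \<subseteq> P \<and> P - R \<notin> \<Theta> \<and> (\<forall>r\<in>R. insert r (P - R) \<in> \<Theta>)"
proof
  assume R: "R \<in> spectrum P le \<Theta>"
  then have sub: "R \<subseteq> P" and rnd: "round_subset le \<Theta> R" and "Cauchy_subset \<Theta> R"
    by (auto simp: spectrum_def upset_in_def)
  moreover have "insert r (P - R) \<in> \<Theta>" if "r \<in> R" for r
  proof -
    have "\<exists>C\<in>\<Theta>. \<forall>c\<in>C \<inter> R. le c r"
      using rnd that unfolding round_subset_def by (rule bspec)
    then obtain C where C: "C \<in> \<Theta>" "\<forall>c\<in>C \<inter> R. le c r" by (elim bexE)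
    have "refines le C (insert r (P - R))"
      using C mem_subset[OF C(1)] le_refl unfolding refines_def by blast
    then show ?thesis using C that sub mem_refined by blast
  qed
  ultimately show "R \<subseteq> P \<and> P - R \<notin> \<Theta> \<and> (\<forall>r\<in>R. insert r (P - R) \<in> \<Theta>)"
    using Cauchy_subset_iff by blast
next
  assume *: "R \<subseteq> P \<and> P - R \<notin> \<Theta> \<and> (\<forall>r\<in>R. insert r (P - R) \<in> \<Theta>)"
  have "q \<in> R" if "r \<in> R" "q \<in> P" "le r q" for r q
  proof (rule ccontr)
    assume "q \<notin> R"
    then have "refines le (insert r (P - R)) (P - R)"
      using that le_refl unfolding refines_def by blast
    then show False using * that mem_refined by blast
  qed
  moreover have "\<exists>C\<in>\<Theta>. \<forall>c\<in>C \<inter> R. le c r" if "r \<in> R" for r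
    using * that le_refl by (intro bexI[of _ "insert r (P - R)"]) auto
  ultimately show "R \<in> spectrum P le \<Theta>"
    using * Cauchy_subset_iff by (auto simp: spectrum_def upset_in_def round_subset_def)
qed

lemma spectrum_antichain:
  assumes "R \<in> spectrum P le \<Theta>" "S \<in> spectrum P le \<Theta>" "R \<subseteq> S"
  shows "R = S"
proof (rule ccontr)
  assume "R \<noteq> S"
  then obtain s where "s \<in> S" "s \<notin> R" using assms by blast
  then have "insert s (P - S) \<in> \<Theta>" "insert s (P - S) \<subseteq> P - R"
    using assms by (auto simp: spectrum_iff)
  then show False using assms mem_superset by (auto simp: spectrum_iff)
qed

lemma spectrum_nearby:
  "\<lbrakk>R \<in> spectrum P le \<Theta>; p \<in> R; q \<in> R\<rbrakk> \<Longrightarrow> nearby p q"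
  unfolding nearby_def spectrum_iff by (intro exI[of _ "P - R"]) auto

lemma spectrum_upset: "\<lbrakk>R \<in> spectrum P le \<Theta>; r \<in> R; le r q; q \<in> P\<rbrakk> \<Longrightarrow> q \<in> R"
  by (auto simp: spectrum_def upset_in_def)

lemma spectrum_meets: "\<lbrakk>R \<in> spectrum P le \<Theta>; C \<in> \<Theta>\<rbrakk> \<Longrightarrow> \<exists>c\<in>C. c \<in> R"
  by (auto simp: spectrum_def Cauchy_subset_def)

lemma spectrum_subset: "R \<in> spectrum P le \<Theta> \<Longrightarrow> R \<subseteq> P"
  by (simp add: spectrum_iff)

section \<open>The topology of the spectrum\<close>

lemma spectrum_at_mono:
  "\<lbrakk>le p q; q \<in> P\<rbrakk> \<Longrightarrow> spectrum_at P le \<Theta> p \<subseteq> spectrum_at P le \<Theta> q"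
  using spectrum_upset by (auto simp: spectrum_at_def)

lemma openin_spectrum_at:
  "p \<in> P \<Longrightarrow> openin (spectrum_topology P le \<Theta>) (spectrum_at P le \<Theta> p)"
  by (simp add: spectrum_topology_def topology_generated_by_Basis)

text \<open>
  Two elements of a point \<open>R\<close> have a common lower bound in \<open>R\<close>: roundness provides for each
  of them a member of \<open>\<Theta>\<close> whose trace on \<open>R\<close> lies below it, and a common refinement of the two
  members meets \<open>R\<close>.
\<close>

lemma spectrum_down_directed:
  assumes R: "R \<in> spectrum P le \<Theta>" and pq: "p \<in> R" "q \<in> R"
  obtains r where "r \<in> R" "le r p" "le r q"
proof -
  have in_theta: "insert p (P - R) \<in> \<Theta>" "insert q (P - R) \<in> \<Theta>"
    using R pq by (auto simp: spectrum_iff)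
  then obtain E where E: "E \<in> \<Theta>" "refines le E (insert p (P - R))"
      "refines le E (insert q (P - R))"
    using common_refinement by blast
  obtain r where r: "r \<in> E" "r \<in> R" using spectrum_meets[OF R E(1)] by blast
  have "le r s" if ref: "refines le E (insert s (P - R))" for s
  proof -
    obtain t where t: "t \<in> insert s (P - R)" "le r t"
      using ref r unfolding refines_def by blast
    then show ?thesis using spectrum_upset[OF R r(2) t(2)] by blast
  qed
  then show thesis using that r E by blast
qed

lemma openin_spectrum_nhd:
  assumes "openin (spectrum_topology P le \<Theta>) U" "R \<in> U"
  obtains r where "r \<in> R" "r \<in> P" "spectrum_at P le \<Theta> r \<subseteq> U"
proof -
  let ?S = "insert (spectrum P le \<Theta>) (spectrum_at P le \<Theta> ` P)"
  have "generate_topology_on ?S U"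
    using assms by (simp add: spectrum_topology_def openin_topology_generated_by)
  then have "U \<subseteq> spectrum P le \<Theta> \<and> (\<forall>R\<in>U. \<exists>r\<in>R. spectrum_at P le \<Theta> r \<subseteq> U)"
  proof induction
    case Empty
    then show ?case by simp
  next
    case (Int a b)
    have "\<exists>r\<in>R. spectrum_at P le \<Theta> r \<subseteq> a \<inter> b" if R: "R \<in> a \<inter> b" for R
    proof -
      obtain p where p: "p \<in> R" "spectrum_at P le \<Theta> p \<subseteq> a" using Int.IH(1) R by blast
      obtain q where q: "q \<in> R" "spectrum_at P le \<Theta> q \<subseteq> b" using Int.IH(2) R by blast
      have RS: "R \<in> spectrum P le \<Theta>" using Int.IH(1) R by blast
      obtain r where "r \<in> R" "le r p" "le r q"
        using spectrum_down_directed[OF RS p(1) q(1)] by blast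
      then show ?thesis
        using p q spectrum_at_mono[of r p] spectrum_at_mono[of r q] spectrum_subset[OF RS] by blast
    qed
    then show ?case using Int by blast
  next
    case (UN K)
    show ?case
    proof (intro conjI ballI)
      show "\<Union>K \<subseteq> spectrum P le \<Theta>" using UN.IH by blast
      fix R assume "R \<in> \<Union>K"
      then obtain k where "k \<in> K" "R \<in> k" by blast
      then obtain r where "r \<in> R" "spectrum_at P le \<Theta> r \<subseteq> k" using UN.IH[of k] by auto
      then show "\<exists>r\<in>R. spectrum_at P le \<Theta> r \<subseteq> \<Union>K" using \<open>k \<in> K\<close> by auto
    qed
  next
    case (Basis s)
    have "\<exists>r\<in>R. spectrum_at P le \<Theta> r \<subseteq> spectrum P le \<Theta>" if "R \<in> spectrum P le \<Theta>" for R
      using spectrum_meets[OF that carrier_mem] by (auto simp: spectrum_at_def)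
    with Basis show ?case by (auto simp: spectrum_at_def)
  qed
  then obtain r where "r \<in> R" "spectrum_at P le \<Theta> r \<subseteq> U" "R \<in> spectrum P le \<Theta>"
    using assms(2) by blast
  then show thesis using that spectrum_subset by blast
qed

lemma topology_basis_spectrum:
  "topology_basis (spectrum_topology P le \<Theta>) (spectrum_at P le \<Theta> ` P)"
  unfolding topology_basis_def
proof (intro conjI ballI allI impI)
  fix b assume "b \<in> spectrum_at P le \<Theta> ` P"
  then show "openin (spectrum_topology P le \<Theta>) b" using openin_spectrum_at by blast
next
  fix U assume U: "openin (spectrum_topology P le \<Theta>) U"
  have "U \<subseteq> \<Union>{b \<in> spectrum_at P le \<Theta> ` P. b \<subseteq> U}"
  proof
    fix R assume R: "R \<in> U"
    obtain r where "r \<in> R" "r \<in> P" "spectrum_at P le \<Theta> r \<subseteq> U"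
      using openin_spectrum_nhd[OF U R] .
    moreover have "R \<in> spectrum P le \<Theta>" using R openin_subset[OF U] by auto
    ultimately show "R \<in> \<Union>{b \<in> spectrum_at P le \<Theta> ` P. b \<subseteq> U}"
      by (auto simp: spectrum_at_def)
  qed
  then show "\<exists>B'\<subseteq>spectrum_at P le \<Theta> ` P. \<Union>B' = U"
    by (intro exI[of _ "{b \<in> spectrum_at P le \<Theta> ` P. b \<subseteq> U}"]) blast
qed

lemma t1_space_spectrum: "t1_space (spectrum_topology P le \<Theta>)"
  unfolding t1_space_def topspace_spectrum_topology
proof (intro ballI impI)
  fix R S assume RS: "R \<in> spectrum P le \<Theta>" "S \<in> spectrum P le \<Theta>" "R \<noteq> S"
  then obtain r where "r \<in> R" "r \<notin> S" using spectrum_antichain by blast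
  then show "\<exists>U. openin (spectrum_topology P le \<Theta>) U \<and> R \<in> U \<and> S \<notin> U"
    using RS spectrum_subset[of R] openin_spectrum_at[of r]
    by (intro exI[of _ "spectrum_at P le \<Theta> r"]) (auto simp: spectrum_at_def)
qed

end

section \<open>The spectrum of a nearly finite admissible filter\<close>

locale nearly_finite_admissible_filter = poset_filter +
  assumes nearly_finite: "nearly_finite P le \<Theta>"
    and admissible: "Wallman_admissible P le \<Theta>"
    and proper: "\<Theta> \<noteq> Pow P"
begin

lemma empty_not_mem: "{} \<notin> \<Theta>"
proof
  assume "{} \<in> \<Theta>"
  then have "Pow P \<subseteq> \<Theta>" using mem_superset by blast
  then show False using proper mem_subset by blast
qed

text \<open>
  Admissibility is used in this form, which supplies the input that separation needs; \<open>D\<close> arises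
  from a member of \<open>\<Theta>\<close> that does not survive the exchange of \<open>p\<close> for \<open>q\<close>.
\<close>

lemma not_le_obtains:
  assumes "p \<in> P" "q \<in> P" "\<not> le p q"
  obtains D where "D \<subseteq> P" "D \<notin> \<Theta>" "q \<in> D" "insert p D \<in> \<Theta>"
proof -
  obtain C where C: "C \<in> \<Theta>" "(C - {p}) \<union> {q} \<notin> \<Theta>"
    using admissible assms unfolding Wallman_admissible_def by blast
  have "insert p ((C - {p}) \<union> {q}) \<in> \<Theta>"
    using C(1) mem_subset[OF C(1)] assms by (intro mem_superset[OF C(1)]) auto
  then show thesis using that[of "(C - {p}) \<union> {q}"] C mem_subset[OF C(1)] assms by blast
qed

text \<open>
  An element \<open>c\<close> below \<open>p\<close> and \<open>q\<close> plays the part of the empty set when these are not near: a set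
  completed by \<open>c\<close> is completed by \<open>p\<close> and by \<open>q\<close>, so it was in \<open>\<Theta>\<close> already.
\<close>

lemma far_lower_bound_removable:
  assumes far: "\<not> nearby p q" and le: "le c p" "le c q" and P: "p \<in> P" "q \<in> P" "c \<in> P"
    and D: "D \<subseteq> P" "insert c D \<in> \<Theta>"
  shows "D \<in> \<Theta>"
proof (rule ccontr)
  assume "D \<notin> \<Theta>"
  have "insert s D \<in> \<Theta>" if "le c s" "s \<in> P" for s
  proof (rule mem_refined[OF D(2)])
    show "refines le (insert c D) (insert s D)"
      using that le_refl D by (auto simp: refines_def)
  qed (use that D in auto)
  then show False using far le P D \<open>D \<notin> \<Theta>\<close> by (auto simp: nearby_def)
qed

lemma far_lower_bound_least:
  assumes "\<not> nearby p q" "le c p" "le c q" "p \<in> P" "q \<in> P" "c \<in> P" "x \<in> P"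
  shows "le c x"
proof (rule ccontr)
  assume "\<not> le c x"
  then obtain D where "D \<subseteq> P" "D \<notin> \<Theta>" "insert c D \<in> \<Theta>"
    using not_le_obtains[OF \<open>c \<in> P\<close> \<open>x \<in> P\<close>] by metis
  then show False using far_lower_bound_removable[OF assms(1-6)] by blast
qed

text \<open>
  In a space: if \<open>D\<close> covers everything outside \<open>p\<close>, and everything outside a union of sets
  disjoint from \<open>p\<close>, then it covers the whole space. Abstractly, take a common refinement of the two
  given members of \<open>\<Theta>\<close>. Its elements that are below no element of \<open>D\<close> are below \<open>p\<close> and below an
  element not near \<open>p\<close>. Hence they are all equal to the least element, and this can be removed.
\<close>

lemma mem_if_mem_insert_if_mem_far:
  assumes D: "D \<subseteq> P" and p: "p \<in> P" "insert p D \<in> \<Theta>"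
    and Q: "Q \<subseteq> P" "D \<union> Q \<in> \<Theta>" and far: "\<And>q. q \<in> Q \<Longrightarrow> \<not> nearby q p"
  shows "D \<in> \<Theta>"
proof -
  obtain C where C: "C \<in> \<Theta>" "refines le C (insert p D)" "refines le C (D \<union> Q)"
    using common_refinement p Q by blast
  have CP: "C \<subseteq> P" using C mem_subset by blast
  have low: "\<exists>q\<in>Q. le c p \<and> le c q" if "c \<in> C" "\<not> (\<exists>d\<in>D. le c d)" for c
    using that C unfolding refines_def by blast
  show ?thesis
  proof (cases "refines le C D")
    case True
    then show ?thesis using C D mem_refined by blast
  next
    case False
    then obtain c where c: "c \<in> C" "\<not> (\<exists>d\<in>D. le c d)" by (auto simp: refines_def)
    obtain q where q: "q \<in> Q" "le c p" "le c q" using low[OF c] by blast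
    have "b = c" if b: "b \<in> C" "\<not> (\<exists>d\<in>D. le b d)" for b
    proof -
      obtain q' where q': "q' \<in> Q" "le b p" "le b q'" using low[OF b] by blast
      have "le b c" using far_lower_bound_least[of q' p b c] q' far b c CP p Q by blast
      moreover have "le c b" using far_lower_bound_least[of q p c b] q far b c CP p Q by blast
      ultimately show ?thesis using le_antisym b c CP by blast
    qed
    then have "refines le (C - {c}) D" unfolding refines_def by blast
    moreover have "C - {c} \<in> \<Theta>"
      using far_lower_bound_removable[of q p c "C - {c}"] q far c C CP p Q
      by (auto simp: insert_absorb)
    ultimately show ?thesis using D mem_refined by blast
  qed
qed

lemma near_finite_refinement:
  assumes "p \<in> P" "C \<in> \<Theta>"
  obtains F where "F \<in> \<Theta>" "finite {f \<in> F. nearby f p}"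
    "refines le {f \<in> F. nearby f p} {c \<in> C. nearby c p}"
  using nearly_finite assms unfolding nearly_finite_iff by blast

text \<open>
  Zorn's lemma applies to the sets above \<open>D\<close> outside \<open>\<Theta>\<close>, although membership in \<open>\<Theta>\<close> is not
  witnessed by finite subsets: it suffices that its part near \<open>p\<close> is.
\<close>

lemma spectrum_separates:
  assumes D: "D \<subseteq> P" "D \<notin> \<Theta>" and p: "p \<in> P" "insert p D \<in> \<Theta>"
  obtains R where "R \<in> spectrum P le \<Theta>" "p \<in> R" "R \<inter> D = {}"
proof -
  define A where "A = {E. D \<subseteq> E \<and> E \<subseteq> P \<and> E \<notin> \<Theta>}"
  have "\<exists>M\<in>A. \<forall>E\<in>A. M \<subseteq> E \<longrightarrow> E = M"
  proof (rule subset_Zorn_nonempty)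
    show "A \<noteq> {}" using D by (auto simp: A_def)
    fix \<C> assume ne: "\<C> \<noteq> {}" and chain: "subset.chain A \<C>"
    then have sub: "\<C> \<subseteq> A" by (simp add: subset.chain_def)
    have "\<Union>\<C> \<notin> \<Theta>"
    proof
      assume "\<Union>\<C> \<in> \<Theta>"
      then obtain F where F: "F \<in> \<Theta>" "finite {f \<in> F. nearby f p}"
          "refines le {f \<in> F. nearby f p} {c \<in> \<Union>\<C>. nearby c p}"
        using near_finite_refinement p by blast
      have "\<forall>f\<in>{f \<in> F. nearby f p}. \<exists>g. g \<in> \<Union>\<C> \<and> le f g"
        using F(3) unfolding refines_def by blast
      from bchoice[OF this] obtain g
        where g: "\<And>f. f \<in> F \<Longrightarrow> nearby f p \<Longrightarrow> g f \<in> \<Union>\<C> \<and> le f (g f)"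
        by auto
      have "finite (g ` {f \<in> F. nearby f p})" "g ` {f \<in> F. nearby f p} \<subseteq> \<Union>\<C>"
        using F(2) g by auto
      then obtain E where E: "E \<in> \<C>" "g ` {f \<in> F. nearby f p} \<subseteq> E"
        using finite_subset_Union_chain[OF _ _ ne chain] by blast
      have EA: "D \<subseteq> E" "E \<subseteq> P" "E \<notin> \<Theta>" using E sub by (auto simp: A_def)
      have FP: "F \<subseteq> P" using F mem_subset by blast
      have "refines le F (E \<union> {f \<in> F. \<not> nearby f p})"
        unfolding refines_def
      proof
        fix f assume "f \<in> F"
        then show "\<exists>s\<in>E \<union> {f \<in> F. \<not> nearby f p}. le f s"
          using g E le_refl FP by (cases "nearby f p") blast+
      qed
      then have "E \<union> {f \<in> F. \<not> nearby f p} \<in> \<Theta>"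
        using F EA FP by (intro mem_refined[OF F(1)]) auto
      moreover have "insert p E \<in> \<Theta>"
        using EA p by (intro mem_superset[OF p(2)]) auto
      ultimately have "E \<in> \<Theta>"
        using EA FP p
        by (intro mem_if_mem_insert_if_mem_far[of E p "{f \<in> F. \<not> nearby f p}"]) auto
      then show False using EA by blast
    qed
    then show "\<Union>\<C> \<in> A" using sub ne by (auto simp: A_def)
  qed
  then obtain M where "M \<in> A" and maxA: "\<forall>E\<in>A. M \<subseteq> E \<longrightarrow> E = M" by (elim bexE)
  then have M: "D \<subseteq> M" "M \<subseteq> P" "M \<notin> \<Theta>" by (auto simp: A_def)
  have max: "E = M" if "D \<subseteq> E" "E \<subseteq> P" "E \<notin> \<Theta>" "M \<subseteq> E" for E
    using maxA that by (simp add: A_def)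
  have dbl: "P - (P - M) = M" using M by blast
  have "insert r M \<in> \<Theta>" if "r \<in> P - M" for r
    using max[of "insert r M"] that M by blast
  then have "P - M \<in> spectrum P le \<Theta>"
    unfolding spectrum_iff dbl using M by blast
  moreover have "p \<notin> M"
  proof
    assume "p \<in> M"
    then show False using M mem_superset[OF p(2), of M] by blast
  qed
  ultimately show thesis using that p M by blast
qed

lemma nearby_iff_spectrum:
  assumes "p \<in> P" "q \<in> P"
  shows "nearby p q \<longleftrightarrow> spectrum_at P le \<Theta> p \<inter> spectrum_at P le \<Theta> q \<noteq> {}"
proof
  assume "nearby p q"
  then obtain D where D: "D \<subseteq> P" "D \<notin> \<Theta>" "insert p D \<in> \<Theta>" "insert q D \<in> \<Theta>"
    by (auto simp: nearby_def)
  then obtain R where R: "R \<in> spectrum P le \<Theta>" "p \<in> R" "R \<inter> D = {}"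
    using spectrum_separates assms by blast
  have "q \<in> R" using spectrum_meets[OF R(1) D(4)] R(3) by blast
  then show "spectrum_at P le \<Theta> p \<inter> spectrum_at P le \<Theta> q \<noteq> {}"
    using R by (auto simp: spectrum_at_def)
next
  assume "spectrum_at P le \<Theta> p \<inter> spectrum_at P le \<Theta> q \<noteq> {}"
  then show "nearby p q" using spectrum_nearby by (auto simp: spectrum_at_def)
qed

lemma le_iff_spectrum_at:
  assumes "p \<in> P" "q \<in> P"
  shows "le p q \<longleftrightarrow> spectrum_at P le \<Theta> p \<subseteq> spectrum_at P le \<Theta> q"
proof
  assume sub: "spectrum_at P le \<Theta> p \<subseteq> spectrum_at P le \<Theta> q"
  show "le p q"
  proof (rule ccontr)
    assume "\<not> le p q"
    then obtain D where "D \<subseteq> P" "D \<notin> \<Theta>" "q \<in> D" "insert p D \<in> \<Theta>"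
      using not_le_obtains assms by blast
    then obtain R where "R \<in> spectrum P le \<Theta>" "p \<in> R" "R \<inter> D = {}"
      using spectrum_separates assms by blast
    then show False using sub \<open>q \<in> D\<close> by (auto simp: spectrum_at_def)
  qed
qed (use assms spectrum_at_mono in blast)

text \<open>
  Two distinct elements are not ordered in at least one direction, so a set outside \<open>\<Theta>\<close> to separate
  from is at hand. In a one-element poset the empty set serves, as \<open>\<Theta>\<close> is proper.
\<close>

lemma spectrum_nonempty: "spectrum P le \<Theta> \<noteq> {}"
proof -
  obtain p where p: "p \<in> P"
    using carrier_mem empty_not_mem by (cases "P = {}") auto
  obtain r D where "r \<in> P" "D \<subseteq> P" "D \<notin> \<Theta>" "insert r D \<in> \<Theta>"
  proof (cases "P = {p}")
    case True
    then show thesis using that[of p "{}"] carrier_mem empty_not_mem by auto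
  next
    case False
    then obtain q where q: "q \<in> P" "q \<noteq> p" using p by blast
    then consider "\<not> le p q" | "\<not> le q p" using le_antisym p by blast
    then show thesis
    proof cases
      case 1
      then show thesis using not_le_obtains that p q by metis
    next
      case 2
      then show thesis using not_le_obtains that p q by metis
    qed
  qed
  then obtain R where "R \<in> spectrum P le \<Theta>" using spectrum_separates by blast
  then show ?thesis by blast
qed

text \<open>
  A member \<open>F\<close> of \<open>\<Theta>\<close> with finitely many elements near \<open>p\<close> exceeds \<open>D\<close> by finitely many elements
  only. They can be removed one at a time: if a removal led out of \<open>\<Theta>\<close>, separation would
  yield a point that avoids \<open>D\<close>.
\<close>

lemma far_cover_mem:
  assumes D: "D \<subseteq> P" and p: "p \<in> P"
    and cover: "\<And>R. R \<in> spectrum P le \<Theta> \<Longrightarrow> R \<inter> D \<noteq> {}"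
    and far: "\<And>q. \<lbrakk>q \<in> P; \<not> nearby q p\<rbrakk> \<Longrightarrow> q \<in> D"
  shows "D \<in> \<Theta>"
proof -
  obtain F where F: "F \<in> \<Theta>" "finite {f \<in> F. nearby f p}"
    using near_finite_refinement[OF p carrier_mem] by blast
  have FP: "F \<subseteq> P" using F mem_subset by blast
  have "D \<union> {f \<in> F. nearby f p} \<in> \<Theta>"
    using F FP D far by (intro mem_superset[OF F(1)]) auto
  moreover have "D \<in> \<Theta>" if "finite G" "G \<subseteq> P" "D \<union> G \<in> \<Theta>" for G
    using that
  proof (induction G)
    case empty
    then show ?case by simp
  next
    case (insert g G)
    have "D \<union> G \<in> \<Theta>"
    proof (rule ccontr)
      assume "D \<union> G \<notin> \<Theta>"
      moreover have "D \<union> G \<subseteq> P" "g \<in> P" "insert g (D \<union> G) \<in> \<Theta>"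
        using insert.prems D by auto
      ultimately obtain R where "R \<in> spectrum P le \<Theta>" "R \<inter> (D \<union> G) = {}"
        using spectrum_separates by blast
      then show False using cover by blast
    qed
    then show ?case using insert by blast
  qed
  ultimately show ?thesis using F FP by blast
qed

lemma star_coinitial_spectrum:
  "star_coinitial (spectrum P le \<Theta>) (spectrum_at P le \<Theta> ` P)
     {spectrum_at P le \<Theta> ` C | C. C \<in> \<Theta>}"
  unfolding star_coinitial_def
proof (intro conjI ballI)
  show "{spectrum_at P le \<Theta> ` C | C. C \<in> \<Theta>} \<subseteq> covers (spectrum P le \<Theta>) (spectrum_at P le \<Theta> ` P)"
  proof (clarsimp simp: covers_def, intro conjI)
    fix C assume C: "C \<in> \<Theta>"
    show "spectrum_at P le \<Theta> ` C \<subseteq> spectrum_at P le \<Theta> ` P" using mem_subset[OF C] by blast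
    show "spectrum P le \<Theta> \<subseteq> (\<Union>x\<in>C. spectrum_at P le \<Theta> x)"
      using spectrum_meets[OF _ C] by (auto simp: spectrum_at_def)
  qed
next
  fix b \<D> assume "b \<in> spectrum_at P le \<Theta> ` P"
    and \<D>: "\<D> \<in> covers (spectrum P le \<Theta>) (spectrum_at P le \<Theta> ` P)"
  then obtain p where p: "p \<in> P" "b = spectrum_at P le \<Theta> p" by blast
  obtain D where D: "D \<subseteq> P" "\<D> = spectrum_at P le \<Theta> ` D"
    using \<D> unfolding covers_def by (auto elim: subset_imageE)
  let ?E = "D \<union> {q \<in> P. \<not> nearby q p}"
  have "?E \<in> \<Theta>"
  proof (rule far_cover_mem)
    fix R assume "R \<in> spectrum P le \<Theta>"
    then have "R \<in> (\<Union>d\<in>D. spectrum_at P le \<Theta> d)" using \<D> D unfolding covers_def by blast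
    then show "R \<inter> ?E \<noteq> {}" by (auto simp: spectrum_at_def)
  qed (use D p in auto)
  moreover have "refines (\<subseteq>) (star_part (spectrum_at P le \<Theta> ` ?E) b) \<D>"
    unfolding refines_def star_part_def
  proof
    fix s assume "s \<in> {c \<in> spectrum_at P le \<Theta> ` ?E. c \<inter> b \<noteq> {}}"
    then obtain c where c: "c \<in> ?E" "s = spectrum_at P le \<Theta> c" "s \<inter> b \<noteq> {}" by blast
    then have "c \<in> D" using nearby_iff_spectrum[of c p] p D by blast
    then show "\<exists>d\<in>\<D>. s \<subseteq> d" using c D by blast
  qed
  ultimately show "\<exists>C\<in>{spectrum_at P le \<Theta> ` C | C. C \<in> \<Theta>}. refines (\<subseteq>) (star_part C b) \<D>"
    by blast
qed

text \<open>
  The basic sets of elements not near \<open>p\<close> cover exactly the complement of the closure. Adding them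
  to a basic cover of the closure gives a member of \<open>\<Theta>\<close>, and a member that is finite near \<open>p\<close>
  and refines it there selects the finite subcover.
\<close>

lemma relatively_compact_spectrum_at:
  assumes p: "p \<in> P"
  shows "relatively_compact_in (spectrum_topology P le \<Theta>) (spectrum_at P le \<Theta> p)"
proof -
  let ?T = "spectrum_topology P le \<Theta>" and ?s = "spectrum_at P le \<Theta>"
  let ?K = "?T closure_of ?s p"
  have nearby_closure: "nearby r p" if "R \<in> ?K" "r \<in> R" for R r
  proof -
    have "R \<in> spectrum P le \<Theta>" using that by (auto simp: in_closure_of)
    then have "r \<in> P" "R \<in> ?s r" using that spectrum_subset by (auto simp: spectrum_at_def)
    then show ?thesis
      using that openin_spectrum_at nearby_iff_spectrum[of r p] p
      by (auto simp: in_closure_of)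
  qed
  have nearby_all: "R \<in> ?K" if "R \<in> spectrum P le \<Theta>" "\<And>r. r \<in> R \<Longrightarrow> nearby r p" for R
    unfolding in_closure_of
  proof (intro conjI allI impI)
    fix U assume "R \<in> U \<and> openin ?T U"
    then obtain r where r: "r \<in> R" "r \<in> P" "?s r \<subseteq> U" using openin_spectrum_nhd by metis
    then show "\<exists>S. S \<in> ?s p \<and> S \<in> U" using that nearby_iff_spectrum[of r p] p by blast
  qed (use that in auto)
  have "compactin ?T ?K"
    unfolding compactin_def
  proof (intro conjI allI impI)
    show "?K \<subseteq> topspace ?T" by (rule closure_of_subset_topspace)
    fix \<U> assume \<U>: "Ball \<U> (openin ?T) \<and> ?K \<subseteq> \<Union>\<U>"
    define D where "D = {d \<in> P. \<exists>U\<in>\<U>. ?s d \<subseteq> U}"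
    let ?E = "D \<union> {q \<in> P. \<not> nearby q p}"
    have "?E \<in> \<Theta>"
    proof (rule far_cover_mem)
      fix R assume R: "R \<in> spectrum P le \<Theta>"
      show "R \<inter> ?E \<noteq> {}"
      proof (cases "R \<in> ?K")
        case True
        then obtain U where U: "U \<in> \<U>" "R \<in> U" using \<U> by blast
        then have "openin ?T U" using \<U> by blast
        then obtain r where "r \<in> R" "r \<in> P" "?s r \<subseteq> U"
          using openin_spectrum_nhd U(2) by metis
        then show ?thesis using U by (auto simp: D_def)
      next
        case False
        then obtain r where "r \<in> R" "\<not> nearby r p" using nearby_all R by blast
        then show ?thesis using spectrum_subset[OF R] by blast
      qed
    qed (use p in \<open>auto simp: D_def\<close>)
    then obtain F where F: "F \<in> \<Theta>" "finite {f \<in> F. nearby f p}"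
        "refines le {f \<in> F. nearby f p} {c \<in> ?E. nearby c p}"
      using near_finite_refinement p by blast
    have "\<forall>f\<in>{f \<in> F. nearby f p}. \<exists>U. U \<in> \<U> \<and> ?s f \<subseteq> U"
    proof
      fix f assume "f \<in> {f \<in> F. nearby f p}"
      then obtain d where "d \<in> D" "le f d" using F(3) unfolding refines_def by blast
      then show "\<exists>U. U \<in> \<U> \<and> ?s f \<subseteq> U"
        using spectrum_at_mono[of f d] unfolding D_def by blast
    qed
    then obtain U where U: "\<forall>f\<in>{f \<in> F. nearby f p}. U f \<in> \<U> \<and> ?s f \<subseteq> U f"
      using bchoice[of "{f \<in> F. nearby f p}" "\<lambda>f U. U \<in> \<U> \<and> ?s f \<subseteq> U"] by blast
    have "?K \<subseteq> \<Union>(U ` {f \<in> F. nearby f p})"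
    proof
      fix R assume R: "R \<in> ?K"
      then have RS: "R \<in> spectrum P le \<Theta>" by (auto simp: in_closure_of)
      obtain f where f: "f \<in> F" "f \<in> R" using spectrum_meets[OF RS F(1)] by blast
      then have "nearby f p" "R \<in> ?s f" using nearby_closure R RS by (auto simp: spectrum_at_def)
      then show "R \<in> \<Union>(U ` {f \<in> F. nearby f p})" using U f by blast
    qed
    then show "\<exists>\<F>. finite \<F> \<and> \<F> \<subseteq> \<U> \<and> ?K \<subseteq> \<Union>\<F>"
      using F(2) U by (intro exI[of _ "U ` {f \<in> F. nearby f p}"]) auto
  qed
  then show ?thesis by (auto simp: relatively_compact_in_def spectrum_at_def)
qed

lemma rc_locally_compact_spectrum: "rc_locally_compact_space (spectrum_topology P le \<Theta>)"
  unfolding rc_locally_compact_space_def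
  using topology_basis_spectrum relatively_compact_spectrum_at by blast

end

section \<open>Coinitial filters of covers of a space\<close>

locale coinitial_cover_filter =
  fixes X :: "'b topology" and P :: "'b set set" and \<Theta> :: "'b set set set"
  assumes nonempty: "topspace X \<noteq> {}"
    and t1: "t1_space X"
    and basis: "topology_basis X P"
    and rel_compact: "\<And>p. p \<in> P \<Longrightarrow> relatively_compact_in X p"
    and mem_covers: "\<Theta> \<subseteq> covers (topspace X) P"
    and coinitial: "star_coinitial (topspace X) P \<Theta>"
    and filter: "filter_family P (\<subseteq>) \<Theta>"
begin

sublocale poset_filter P "(\<subseteq>)" \<Theta>
  by unfold_locales
    (use filter in \<open>auto simp: poset_on_def reflp_on_def transp_on_def antisymp_on_def\<close>)

lemma openin_basic: "p \<in> P \<Longrightarrow> openin X p"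
  using basis by (auto simp: topology_basis_def)

lemma basic_subset: "p \<in> P \<Longrightarrow> p \<subseteq> topspace X"
  using openin_basic openin_subset by blast

lemma basic_nhd:
  assumes "openin X U" "x \<in> U"
  obtains p where "p \<in> P" "x \<in> p" "p \<subseteq> U"
  using basis assms unfolding topology_basis_def by (metis Union_iff Union_upper subsetD)

lemma mem_cover: "C \<in> \<Theta> \<Longrightarrow> topspace X \<subseteq> \<Union>C"
  using mem_covers by (auto simp: covers_def)

text \<open>
  Coinitiality yields a member of \<open>\<Theta>\<close> whose elements meeting \<open>p\<close> refine \<open>E\<close>; its other elements
  belong to \<open>E\<close>.
\<close>

lemma disjoint_cover_mem:
  assumes p: "p \<in> P" and E: "E \<subseteq> P" "topspace X \<subseteq> \<Union>E"
    and disj: "\<And>q. \<lbrakk>q \<in> P; q \<inter> p = {}\<rbrakk> \<Longrightarrow> q \<in> E"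
  shows "E \<in> \<Theta>"
proof -
  have "E \<in> covers (topspace X) P" using E by (simp add: covers_def)
  then obtain C where C: "C \<in> \<Theta>" "refines (\<subseteq>) (star_part C p) E"
    using coinitial p unfolding star_coinitial_def by blast
  have "refines (\<subseteq>) C E"
    unfolding refines_def
  proof
    fix c assume "c \<in> C"
    then show "\<exists>e\<in>E. c \<subseteq> e"
      using C(2) disj[of c] mem_subset[OF C(1)]
      by (cases "c \<inter> p = {}") (auto simp: refines_def star_part_def)
  qed
  then show ?thesis using mem_refined C E by blast
qed

lemma missing_family_not_mem: "x \<in> topspace X \<Longrightarrow> {d \<in> P. x \<notin> d} \<notin> \<Theta>"
  using mem_cover by blast

lemma insert_missing_family_mem:
  assumes p: "p \<in> P" "x \<in> p"
  shows "insert p {d \<in> P. x \<notin> d} \<in> \<Theta>"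
proof (rule disjoint_cover_mem[OF p(1)])
  show "topspace X \<subseteq> \<Union>(insert p {d \<in> P. x \<notin> d})"
  proof
    fix y assume y: "y \<in> topspace X"
    show "y \<in> \<Union>(insert p {d \<in> P. x \<notin> d})"
    proof (cases "y = x")
      case True
      then show ?thesis using p by blast
    next
      case False
      have "x \<in> topspace X" using p basic_subset by blast
      then obtain U where U: "openin X U" "y \<in> U" "x \<notin> U"
        using t1 False y unfolding t1_space_def by blast
      then obtain d where "d \<in> P" "y \<in> d" "d \<subseteq> U" using basic_nhd by blast
      then show ?thesis using U by blast
    qed
  qed
qed (use p in auto)

text \<open>
  If \<open>p\<close> and \<open>q\<close> are disjoint and both complete \<open>D\<close>, then a common refinement of the two
  completions refines \<open>D\<close>, except perhaps for the empty set, which lies below every element of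
  \<open>D\<close>. There is one, since \<open>D\<close> covers the nonempty space.
\<close>

lemma nearby_iff_Int_nonempty:
  assumes "p \<in> P" "q \<in> P"
  shows "nearby p q \<longleftrightarrow> p \<inter> q \<noteq> {}"
proof
  assume "nearby p q"
  then obtain D where D: "D \<subseteq> P" "D \<notin> \<Theta>" "insert p D \<in> \<Theta>" "insert q D \<in> \<Theta>"
    by (auto simp: nearby_def)
  show "p \<inter> q \<noteq> {}"
  proof
    assume disj: "p \<inter> q = {}"
    obtain C where C: "C \<in> \<Theta>" "refines (\<subseteq>) C (insert p D)" "refines (\<subseteq>) C (insert q D)"
      using common_refinement D by blast
    obtain x where "x \<in> topspace X" using nonempty by blast
    then have "D \<noteq> {}"
      using mem_cover[OF D(3)] mem_cover[OF D(4)] disj by auto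
    then have "refines (\<subseteq>) C D"
      using C(2,3) disj unfolding refines_def by (metis Int_greatest empty_subsetI equals0I
          insert_iff subset_empty)
    then show False using C D mem_refined by blast
  qed
next
  assume "p \<inter> q \<noteq> {}"
  then obtain x where x: "x \<in> p" "x \<in> q" by blast
  then show "nearby p q"
    using insert_missing_family_mem[of p x] insert_missing_family_mem[of q x] assms
      missing_family_not_mem[of x] basic_subset
    unfolding nearby_def by (intro exI[of _ "{d \<in> P. x \<notin> d}"]) blast
qed

text \<open>
  A finite part of \<open>C\<close> covers the compact closure of \<open>p\<close>, and the basic sets disjoint from \<open>p\<close>
  cover the rest of the space.
\<close>

lemma nearly_finite_covers: "nearly_finite P (\<subseteq>) \<Theta>"
  unfolding nearly_finite_iff
proof (intro ballI)
  fix p C assume p: "p \<in> P" and C: "C \<in> \<Theta>"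
  have CP: "C \<subseteq> P" using mem_subset[OF C] .
  let ?K = "X closure_of p"
  have "compactin X ?K" using rel_compact[OF p] by (simp add: relatively_compact_in_def)
  moreover have "?K \<subseteq> \<Union>C"
    using closure_of_subset_topspace mem_cover[OF C] by (rule order_trans)
  moreover have "\<And>c. c \<in> C \<Longrightarrow> openin X c" using CP openin_basic by blast
  ultimately obtain G where G: "finite G" "G \<subseteq> C" "?K \<subseteq> \<Union>G"
    using compactinD[of X ?K C] by metis
  define F where "F = G \<union> {q \<in> P. q \<inter> p = {}}"
  have "F \<in> \<Theta>"
  proof (rule disjoint_cover_mem[OF p])
    show "topspace X \<subseteq> \<Union>F"
    proof
      fix x assume x: "x \<in> topspace X"
      show "x \<in> \<Union>F"
      proof (cases "x \<in> ?K")
        case True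
        then show ?thesis using G by (auto simp: F_def)
      next
        case False
        then obtain U where U: "openin X U" "x \<in> U" "U \<inter> p = {}"
          using x by (auto simp: in_closure_of)
        obtain q where "q \<in> P" "x \<in> q" "q \<subseteq> U" using basic_nhd[OF U(1,2)] .
        then have "q \<in> P" "x \<in> q" "q \<inter> p = {}" using U(3) by auto
        then show ?thesis by (auto simp: F_def)
      qed
    qed
  qed (use G CP in \<open>auto simp: F_def\<close>)
  moreover have sub: "{f \<in> F. nearby f p} \<subseteq> {c \<in> G. nearby c p}"
    using nearby_iff_Int_nonempty p by (auto simp: F_def)
  then have "finite {f \<in> F. nearby f p}" using G by (auto intro: finite_subset)
  moreover have "refines (\<subseteq>) {f \<in> F. nearby f p} {c \<in> C. nearby c p}"
    using sub G unfolding refines_def by blast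
  ultimately show "\<exists>F\<in>\<Theta>. finite {f \<in> F. nearby f p} \<and>
      refines (\<subseteq>) {f \<in> F. nearby f p} {c \<in> C. nearby c p}"
    by blast
qed

text \<open>
  For \<open>x\<close> in \<open>p\<close> but not in \<open>q\<close>, exchanging \<open>p\<close> for \<open>q\<close> in the cover formed by \<open>p\<close> and the basic
  sets that miss \<open>x\<close> leaves \<open>x\<close> uncovered.
\<close>

lemma Wallman_admissible_covers: "Wallman_admissible P (\<subseteq>) \<Theta>"
  unfolding Wallman_admissible_def
proof (intro ballI iffI)
  fix p q C assume pq: "p \<in> P" "q \<in> P" "p \<subseteq> q" and C: "C \<in> \<Theta>"
  have "refines (\<subseteq>) C ((C - {p}) \<union> {q})" using pq unfolding refines_def by blast
  then show "(C - {p}) \<union> {q} \<in> \<Theta>" using C mem_subset[OF C] pq mem_refined by blast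
next
  fix p q assume pq: "p \<in> P" "q \<in> P" and ex: "\<forall>C\<in>\<Theta>. (C - {p}) \<union> {q} \<in> \<Theta>"
  show "p \<subseteq> q"
  proof
    fix x assume x: "x \<in> p"
    then have "(insert p {d \<in> P. x \<notin> d} - {p}) \<union> {q} \<in> \<Theta>"
      using ex insert_missing_family_mem pq by blast
    moreover have "x \<in> topspace X" using x pq basic_subset by blast
    ultimately have "x \<in> \<Union>((insert p {d \<in> P. x \<notin> d} - {p}) \<union> {q})"
      using mem_cover by blast
    then show "x \<in> q" by auto
  qed
qed

definition basic_nhds :: "'b \<Rightarrow> 'b set set" where
  "basic_nhds x = {p \<in> P. x \<in> p}"

lemma basic_nhds_in_spectrum:
  assumes "x \<in> topspace X"
  shows "basic_nhds x \<in> spectrum P (\<subseteq>) \<Theta>"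
proof -
  have "P - basic_nhds x = {d \<in> P. x \<notin> d}" by (auto simp: basic_nhds_def)
  then show ?thesis
    using assms missing_family_not_mem insert_missing_family_mem
    by (auto simp: spectrum_iff basic_nhds_def)
qed

text \<open>
  The complement of a point \<open>R\<close> contains every basic set disjoint from a given element of \<open>R\<close>, so it
  would be in \<open>\<Theta>\<close> if it were a cover. Hence it misses some \<open>x\<close>. Then all basic neighbourhoods of
  \<open>x\<close> are in \<open>R\<close>, and equality holds since points of the spectrum form an antichain.
\<close>

lemma spectrum_eq_basic_nhds:
  assumes R: "R \<in> spectrum P (\<subseteq>) \<Theta>"
  obtains x where "x \<in> topspace X" "R = basic_nhds x"
proof -
  obtain p where p: "p \<in> R" using spectrum_meets[OF R carrier_mem] by blast
  have "\<not> topspace X \<subseteq> \<Union>(P - R)"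
  proof
    assume "topspace X \<subseteq> \<Union>(P - R)"
    moreover have "q \<in> P - R" if "q \<in> P" "q \<inter> p = {}" for q
      using that spectrum_nearby[OF R _ p] nearby_iff_Int_nonempty spectrum_subset[OF R] p by blast
    ultimately have "P - R \<in> \<Theta>"
      using disjoint_cover_mem[of p "P - R"] p spectrum_subset[OF R] by blast
    then show False using R by (simp add: spectrum_iff)
  qed
  then obtain x where x: "x \<in> topspace X" "x \<notin> \<Union>(P - R)" by blast
  then have "basic_nhds x \<subseteq> R" by (auto simp: basic_nhds_def)
  then show thesis using that x spectrum_antichain[OF basic_nhds_in_spectrum R] by blast
qed

lemma image_basic_nhds: "p \<in> P \<Longrightarrow> basic_nhds ` p = spectrum_at P (\<subseteq>) \<Theta> p"
proof (intro equalityI subsetI)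
  fix R assume p: "p \<in> P" and "R \<in> basic_nhds ` p"
  then obtain x where "x \<in> p" "R = basic_nhds x" by blast
  then show "R \<in> spectrum_at P (\<subseteq>) \<Theta> p"
    using p basic_nhds_in_spectrum basic_subset by (auto simp: spectrum_at_def basic_nhds_def)
next
  fix R assume p: "p \<in> P" and R: "R \<in> spectrum_at P (\<subseteq>) \<Theta> p"
  then obtain x where "R = basic_nhds x"
    using spectrum_eq_basic_nhds by (auto simp: spectrum_at_def)
  then show "R \<in> basic_nhds ` p" using R by (auto simp: spectrum_at_def basic_nhds_def)
qed

lemma homeomorphic_map_basic_nhds:
  "homeomorphic_map X (spectrum_topology P (\<subseteq>) \<Theta>) basic_nhds"
proof (rule bijective_open_imp_homeomorphic_map)
  show onto: "basic_nhds ` topspace X = topspace (spectrum_topology P (\<subseteq>) \<Theta>)"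
    using basic_nhds_in_spectrum spectrum_eq_basic_nhds by (auto simp: image_iff) metis
  show "continuous_map X (spectrum_topology P (\<subseteq>) \<Theta>) basic_nhds"
    unfolding spectrum_topology_def
  proof (rule continuous_on_generated_topo)
    fix U assume "U \<in> insert (spectrum P (\<subseteq>) \<Theta>) (spectrum_at P (\<subseteq>) \<Theta> ` P)"
    then consider "U = spectrum P (\<subseteq>) \<Theta>" | p where "p \<in> P" "U = spectrum_at P (\<subseteq>) \<Theta> p"
      by blast
    then show "openin X (basic_nhds -` U \<inter> topspace X)"
    proof cases
      case 1
      then have "basic_nhds -` U \<inter> topspace X = topspace X"
        using basic_nhds_in_spectrum by blast
      then show ?thesis by simp
    next
      case 2
      then have "basic_nhds -` U \<inter> topspace X = p"
        using basic_nhds_in_spectrum basic_subset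
        by (auto simp: spectrum_at_def basic_nhds_def)
      then show ?thesis using 2 openin_basic by simp
    qed
  qed (use onto in auto)
  show "open_map X (spectrum_topology P (\<subseteq>) \<Theta>) basic_nhds"
    unfolding open_map_def
  proof (intro allI impI)
    fix U assume "openin X U"
    then obtain B where B: "B \<subseteq> P" "U = \<Union>B"
      using basis unfolding topology_basis_def by blast
    then have "basic_nhds ` U = \<Union>(spectrum_at P (\<subseteq>) \<Theta> ` B)"
      using image_basic_nhds by (auto simp: image_Union subset_iff)
    moreover have "openin (spectrum_topology P (\<subseteq>) \<Theta>) (\<Union>(spectrum_at P (\<subseteq>) \<Theta> ` B))"
      using B(1) openin_spectrum_at by (intro openin_Union) blast
    ultimately show "openin (spectrum_topology P (\<subseteq>) \<Theta>) (basic_nhds ` U)" by simp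
  qed
  show "inj_on basic_nhds (topspace X)"
  proof (rule inj_onI, rule ccontr)
    fix x y assume xy: "x \<in> topspace X" "y \<in> topspace X" "basic_nhds x = basic_nhds y" "x \<noteq> y"
    then obtain U where "openin X U" "x \<in> U" "y \<notin> U"
      using t1 unfolding t1_space_def by blast
    then obtain p where "p \<in> P" "x \<in> p" "y \<notin> p" using basic_nhd by blast
    then show False using xy by (auto simp: basic_nhds_def)
  qed
qed

lemma spectrum_homeomorphic: "spectrum_topology P (\<subseteq>) \<Theta> homeomorphic_space X"
  using homeomorphic_map_basic_nhds homeomorphic_map_imp_homeomorphic_space
    homeomorphic_space_sym by blast

end

section \<open>The duality\<close>

theorem theorem7p9:
  "(\<forall>(P :: 'a set) (le :: 'a \<Rightarrow> 'a \<Rightarrow> bool) (\<Theta> :: 'a set set).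
      poset_on P le \<and> \<Theta> \<subseteq> Pow P \<and> nearly_finite P le \<Theta> \<and> Wallman_admissible P le \<Theta> \<and>
      filter_family P le \<Theta> \<and> \<Theta> \<noteq> Pow P \<longrightarrow>
        topspace (spectrum_topology P le \<Theta>) \<noteq> {} \<and>
        rc_locally_compact_space (spectrum_topology P le \<Theta>) \<and>
        t1_space (spectrum_topology P le \<Theta>) \<and>
        topology_basis (spectrum_topology P le \<Theta>) (spectrum_at P le \<Theta> ` P) \<and>
        (\<forall>p\<in>P. relatively_compact_in (spectrum_topology P le \<Theta>) (spectrum_at P le \<Theta> p)) \<and>
        (\<forall>p\<in>P. \<forall>q\<in>P. le p q \<longleftrightarrow> spectrum_at P le \<Theta> p \<subseteq> spectrum_at P le \<Theta> q) \<and>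
        star_coinitial (spectrum P le \<Theta>) (spectrum_at P le \<Theta> ` P)
          {spectrum_at P le \<Theta> ` C | C. C \<in> \<Theta>}) \<and>
   (\<forall>(X :: 'b topology) (P :: 'b set set) (\<Theta> :: 'b set set set).
      topspace X \<noteq> {} \<and> t1_space X \<and>
      topology_basis X P \<and> (\<forall>p\<in>P. relatively_compact_in X p) \<and>
      \<Theta> \<subseteq> covers (topspace X) P \<and> star_coinitial (topspace X) P \<Theta> \<and>
      filter_family P (\<subseteq>) \<Theta> \<longrightarrow>
        nearly_finite P (\<subseteq>) \<Theta> \<and> Wallman_admissible P (\<subseteq>) \<Theta> \<and>
        spectrum_topology P (\<subseteq>) \<Theta> homeomorphic_space X)"
proof (intro conjI allI impI; elim conjE)
  fix P :: "'a set" and le \<Theta>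
  assume "poset_on P le" "nearly_finite P le \<Theta>" "Wallman_admissible P le \<Theta>"
    "filter_family P le \<Theta>" "\<Theta> \<noteq> Pow P"
  then interpret nearly_finite_admissible_filter P le \<Theta>
    by unfold_locales
  show "topspace (spectrum_topology P le \<Theta>) \<noteq> {}" using spectrum_nonempty by simp
  show "rc_locally_compact_space (spectrum_topology P le \<Theta>)" by (rule rc_locally_compact_spectrum)
  show "t1_space (spectrum_topology P le \<Theta>)" by (rule t1_space_spectrum)
  show "topology_basis (spectrum_topology P le \<Theta>) (spectrum_at P le \<Theta> ` P)"
    by (rule topology_basis_spectrum)
  show "\<forall>p\<in>P. relatively_compact_in (spectrum_topology P le \<Theta>) (spectrum_at P le \<Theta> p)"
    using relatively_compact_spectrum_at by blast
  show "\<forall>p\<in>P. \<forall>q\<in>P. le p q \<longleftrightarrow> spectrum_at P le \<Theta> p \<subseteq> spectrum_at P le \<Theta> q"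
    using le_iff_spectrum_at by blast
  show "star_coinitial (spectrum P le \<Theta>) (spectrum_at P le \<Theta> ` P)
      {spectrum_at P le \<Theta> ` C | C. C \<in> \<Theta>}"
    by (rule star_coinitial_spectrum)
next
  fix X :: "'b topology" and P \<Theta>
  assume "topspace X \<noteq> {}" "t1_space X" "topology_basis X P"
    "\<forall>p\<in>P. relatively_compact_in X p" "\<Theta> \<subseteq> covers (topspace X) P"
    "star_coinitial (topspace X) P \<Theta>" "filter_family P (\<subseteq>) \<Theta>"
  then interpret coinitial_cover_filter X P \<Theta>
    by unfold_locales blast+
  show "nearly_finite P (\<subseteq>) \<Theta>" by (rule nearly_finite_covers)
  show "Wallman_admissible P (\<subseteq>) \<Theta>" by (rule Wallman_admissible_covers)
  show "spectrum_topology P (\<subseteq>) \<Theta> homeomorphic_space X" by (rule spectrum_homeomorphic)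
qed

end
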